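(* Let $Q:\mathbb{R}^n\to\mathcal{Z}$ be a quantizer, $\mathbf{S}\in\mathbb{R}^{n\times m}$, $z\in\mathcal{Z}$, $\mathbf{x}_0,\mathbf{x}_1\in\mathbb{R}^m$, $\boldsymbol{\Psi}_0,\boldsymbol{\Psi}_1\in\mathcal{P}_n$ and $\alpha\in[0,1]$. Set $\mathcal{A}_i:=\mathcal{W}(z,\mathbf{x}_i,\boldsymbol{\Psi}_i)$ for $i\in\{0,1\}$, $\mathbf{x}_\alpha=\alpha\mathbf{x}_1+(1-\alpha)\mathbf{x}_0$, $\boldsymbol{\Psi}_\alpha=\alpha\boldsymbol{\Psi}_1+(1-\alpha)\boldsymbol{\Psi}_0$, and $\mathcal{A}_\alpha:=\{\alpha\mathbf{w}_1+(1-\alpha)\mathbf{w}_0:\mathbf{w}_1\in\mathcal{A}_1,\mathbf{w}_0\in\mathcal{A}_0\}$. Suppose one of the following holds: (a) $Q^{-1}(z)$ is convex and $\boldsymbol{\Psi}_1=\boldsymbol{\Psi}_0$; (b) $Q^{-1}(z)$ is convex and $\boldsymbol{\Psi}_i=\psi_i\mathbf{I}_n$ with $\psi_i>0$ for $i\in\{0,1\}$; (c) $\boldsymbol{\Psi}_0,\boldsymbol{\Psi}_1$ are diagonal with positive diagonal entries and $Q^{-1}(z)=\prod_{j=1}^n[a_j,b_j]$ for some $a_j\le b_j$ in $\mathbb{R}\cup\{-\infty,+\infty\}$ (each factor understood as the corresponding closed interval of $\mathbb{R}$). Then $\mathcal{A}_\alpha\subseteq\mathcal{W}(z,\mathbf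{x}_\alpha,\boldsymbol{\Psi}_\alpha)$.
   Context: $\mathcal{P}_n$ denotes the set of $n\times n$ real symmetric positive-definite matrices; $\mathbf{I}_n$ is the identity. A quantizer is any map $Q:\mathbb{R}^n\to\mathcal{Z}$ with $\mathcal{Z}$ countable. For $z\in\mathcal{Z}$, $\mathbf{x}\in\mathbb{R}^m$, $\boldsymbol{\Psi}\in\mathcal{P}_n$, define $\mathcal{W}(z,\mathbf{x},\boldsymbol{\Psi}):=\{\mathbf{w}\in\mathbb{R}^n:\boldsymbol{\Psi}^{-1}(\mathbf{S}\mathbf{x}+\mathbf{w})\in Q^{-1}(z)\}=\{\boldsymbol{\Psi}\mathbf{y}-\mathbf{S}\mathbf{x}:\mathbf{y}\in Q^{-1}(z)\}$. *)

theory Defs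
  imports "HOL-Analysis.Analysis" "HOL-Library.Extended_Real"
begin

text \<open>Symmetric positive-definite n x n real matrices.\<close>
definition pos_def_mat :: "real^'n^'n \<Rightarrow> bool" where
  "pos_def_mat P \<longleftrightarrow> transpose P = P \<and> (\<forall>v. v \<noteq> 0 \<longrightarrow> v \<bullet> (P *v v) > 0)"

text \<open>W(z,x,Psi) = {w. Psi^{-1}(S x + w) in Q^{-1}(z)}, for quantizer Q and matrix S.\<close>
definition Wset :: "(real^'n \<Rightarrow> 'z) \<Rightarrow> real^'m^'n \<Rightarrow> 'z \<Rightarrow> real^'m \<Rightarrow> real^'n^'n \<Rightarrow> (real^'n) set" where
  "Wset Q S z x P = {w. matrix_inv P *v (S *v x + w) \<in> Q -` {z}}"

end

theory Submission
  imports Defs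
begin

text \<open>
  Write \<open>C = Q\<^sup>-\<^sup>1(z)\<close>. For invertible \<open>\<Psi>\<close>, \<open>w \<in> W(z,x,\<Psi>)\<close> means that \<open>S x + w = \<Psi> y\<close> for some
  \<open>y \<in> C\<close>. Mixing \<open>w\<^sub>1, w\<^sub>0\<close> therefore mixes the right-hand sides to \<open>\<alpha> \<Psi>\<^sub>1 y\<^sub>1 + (1 - \<alpha>) \<Psi>\<^sub>0 y\<^sub>0\<close>,
  and all that has to be shown is that this point lies in \<open>\<Psi>\<^sub>\<alpha> C\<close>, where \<open>\<Psi>\<^sub>\<alpha>\<close> is again
  positive definite, hence invertible. Under (a) this is plain convexity of \<open>C\<close>. Under (b),
  and coordinatewise under (c), the point is \<open>u y\<^sub>1 + v y\<^sub>0\<close> with \<open>u, v \<ge> 0\<close> and \<open>u + v\<close> the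
  corresponding entry of \<open>\<Psi>\<^sub>\<alpha>\<close>, i.e. \<open>(u + v)\<close> times a convex combination of \<open>y\<^sub>1, y\<^sub>0\<close>.
\<close>

lemma matrix_inv_cancel:
  fixes P :: "real^'n^'n"
  assumes "invertible P"
  shows "matrix_inv P *v (P *v y) = y" and "P *v (matrix_inv P *v y) = y"
proof -
  have "P ** matrix_inv P = mat 1 \<and> matrix_inv P ** P = mat 1"
    using assms unfolding invertible_def matrix_inv_def by (rule someI_ex)
  then show "matrix_inv P *v (P *v y) = y" and "P *v (matrix_inv P *v y) = y"
    by (simp_all add: matrix_vector_mul_assoc)
qed

lemma pos_def_mat_invertible:
  assumes "pos_def_mat (P :: real^'n^'n)"
  shows "invertible P"
proof -
  have "\<forall>v. P *v v = 0 \<longrightarrow> v = 0"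
    using assms unfolding pos_def_mat_def by (metis inner_zero_right less_irrefl)
  then show ?thesis
    using matrix_left_invertible_ker invertible_left_inverse by blast
qed

lemma convex_comb_pos:
  fixes p0 p1 \<alpha> :: real
  assumes "0 < p0" "0 < p1" "0 \<le> \<alpha>" "\<alpha> \<le> 1"
  shows "0 < \<alpha> * p1 + (1 - \<alpha>) * p0"
  using assms by (cases "\<alpha> = 0") (auto intro: add_pos_nonneg)

lemma pos_def_mat_convex_comb:
  fixes P0 P1 :: "real^'n^'n"
  assumes "pos_def_mat P0" "pos_def_mat P1" "0 \<le> \<alpha>" "\<alpha> \<le> 1"
  shows "pos_def_mat (\<alpha> *\<^sub>R P1 + (1 - \<alpha>) *\<^sub>R P0)"
  unfolding pos_def_mat_def
proof (intro conjI allI impI)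
  show "transpose (\<alpha> *\<^sub>R P1 + (1 - \<alpha>) *\<^sub>R P0) = \<alpha> *\<^sub>R P1 + (1 - \<alpha>) *\<^sub>R P0"
    using assms unfolding pos_def_mat_def by (simp add: transpose_def vec_eq_iff)
next
  fix v :: "real^'n"
  assume "v \<noteq> 0"
  then have "0 < \<alpha> * (v \<bullet> (P1 *v v)) + (1 - \<alpha>) * (v \<bullet> (P0 *v v))"
    using assms unfolding pos_def_mat_def by (intro convex_comb_pos) auto
  then show "0 < v \<bullet> ((\<alpha> *\<^sub>R P1 + (1 - \<alpha>) *\<^sub>R P0) *v v)"
    by (simp add: matrix_vector_mult_add_rdistrib scaleR_matrix_vector_assoc[symmetric]
        inner_add_right)
qed

lemma Wset_iff:
  assumes "invertible P"
  shows "w \<in> Wset Q S z x P \<longleftrightarrow> S *v x + w \<in> (*v) P ` (Q -` {z})"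
proof
  assume "w \<in> Wset Q S z x P"
  then show "S *v x + w \<in> (*v) P ` (Q -` {z})"
    unfolding Wset_def using matrix_inv_cancel(2)[OF assms] by (metis CollectD image_eqI)
next
  assume "S *v x + w \<in> (*v) P ` (Q -` {z})"
  then show "w \<in> Wset Q S z x P"
    unfolding Wset_def using matrix_inv_cancel(1)[OF assms] by auto
qed

lemma Wset_convex_comb_subset:
  fixes P0 P1 :: "real^'n^'n"
  assumes "invertible P0" "invertible P1" "invertible (\<alpha> *\<^sub>R P1 + (1 - \<alpha>) *\<^sub>R P0)"
    and mix: "\<And>y0 y1. y0 \<in> Q -` {z} \<Longrightarrow> y1 \<in> Q -` {z} \<Longrightarrow>
      \<alpha> *\<^sub>R (P1 *v y1) + (1 - \<alpha>) *\<^sub>R (P0 *v y0) \<in> (*v) (\<alpha> *\<^sub>R P1 + (1 - \<alpha>) *\<^sub>R P0) ` (Q -` {z})"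
  shows "{\<alpha> *\<^sub>R w1 + (1 - \<alpha>) *\<^sub>R w0 | w1 w0.
            w1 \<in> Wset Q S z x1 P1 \<and> w0 \<in> Wset Q S z x0 P0}
         \<subseteq> Wset Q S z (\<alpha> *\<^sub>R x1 + (1 - \<alpha>) *\<^sub>R x0) (\<alpha> *\<^sub>R P1 + (1 - \<alpha>) *\<^sub>R P0)"
proof clarify
  fix w1 w0
  assume "w1 \<in> Wset Q S z x1 P1" "w0 \<in> Wset Q S z x0 P0"
  then obtain y1 y0 where y: "y1 \<in> Q -` {z}" "y0 \<in> Q -` {z}"
    and y1: "S *v x1 + w1 = P1 *v y1" and y0: "S *v x0 + w0 = P0 *v y0"
    unfolding Wset_iff[OF assms(1)] Wset_iff[OF assms(2)] by blast
  have "S *v (\<alpha> *\<^sub>R x1 + (1 - \<alpha>) *\<^sub>R x0) + (\<alpha> *\<^sub>R w1 + (1 - \<alpha>) *\<^sub>R w0)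
      = \<alpha> *\<^sub>R (S *v x1 + w1) + (1 - \<alpha>) *\<^sub>R (S *v x0 + w0)"
    by (simp add: matrix_vector_right_distrib matrix_vector_mult_scaleR algebra_simps)
  also have "\<dots> = \<alpha> *\<^sub>R (P1 *v y1) + (1 - \<alpha>) *\<^sub>R (P0 *v y0)"
    by (simp only: y1 y0)
  finally have "S *v (\<alpha> *\<^sub>R x1 + (1 - \<alpha>) *\<^sub>R x0) + (\<alpha> *\<^sub>R w1 + (1 - \<alpha>) *\<^sub>R w0)
      = \<alpha> *\<^sub>R (P1 *v y1) + (1 - \<alpha>) *\<^sub>R (P0 *v y0)" .
  then show "\<alpha> *\<^sub>R w1 + (1 - \<alpha>) *\<^sub>R w0
      \<in> Wset Q S z (\<alpha> *\<^sub>R x1 + (1 - \<alpha>) *\<^sub>R x0) (\<alpha> *\<^sub>R P1 + (1 - \<alpha>) *\<^sub>R P0)"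
    unfolding Wset_iff[OF assms(3)] using mix[OF y(2,1)] by (simp only:)
qed

lemma convex_nonneg_comb_in_scaled:
  fixes C :: "'a::real_vector set"
  assumes "convex C" "x \<in> C" "y \<in> C" "0 \<le> u" "0 \<le> v" "0 < u + v"
  shows "u *\<^sub>R x + v *\<^sub>R y \<in> (*\<^sub>R) (u + v) ` C"
proof
  show "(u / (u + v)) *\<^sub>R x + (v / (u + v)) *\<^sub>R y \<in> C"
    using assms by (intro convexD) (auto simp: add_divide_distrib[symmetric])
  show "u *\<^sub>R x + v *\<^sub>R y = (u + v) *\<^sub>R ((u / (u + v)) *\<^sub>R x + (v / (u + v)) *\<^sub>R y)"
    using assms(6) by (simp add: scaleR_add_right)
qed

lemma convex_mix_same_matrix:
  fixes P :: "real^'n^'n"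
  assumes "convex C" "y0 \<in> C" "y1 \<in> C" "0 \<le> \<alpha>" "\<alpha> \<le> 1"
  shows "\<alpha> *\<^sub>R (P *v y1) + (1 - \<alpha>) *\<^sub>R (P *v y0) \<in> (*v) (\<alpha> *\<^sub>R P + (1 - \<alpha>) *\<^sub>R P) ` C"
proof
  show "\<alpha> *\<^sub>R y1 + (1 - \<alpha>) *\<^sub>R y0 \<in> C"
    using assms by (intro convexD) auto
  show "\<alpha> *\<^sub>R (P *v y1) + (1 - \<alpha>) *\<^sub>R (P *v y0)
      = (\<alpha> *\<^sub>R P + (1 - \<alpha>) *\<^sub>R P) *v (\<alpha> *\<^sub>R y1 + (1 - \<alpha>) *\<^sub>R y0)"
    by (simp add: matrix_vector_right_distrib matrix_vector_mult_scaleR scaleR_add_left[symmetric])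
qed

lemma convex_mix_scalar_matrices:
  assumes "convex C" "y0 \<in> C" "y1 \<in> C" "0 \<le> \<alpha>" "\<alpha> \<le> 1" "0 < p0" "0 < p1"
  shows "\<alpha> *\<^sub>R ((p1 *\<^sub>R mat 1) *v y1) + (1 - \<alpha>) *\<^sub>R ((p0 *\<^sub>R mat 1) *v y0)
    \<in> (*v) (\<alpha> *\<^sub>R (p1 *\<^sub>R mat 1) + (1 - \<alpha>) *\<^sub>R (p0 *\<^sub>R (mat 1 :: real^'n^'n))) ` C"
proof -
  have "(\<alpha> * p1) *\<^sub>R y1 + ((1 - \<alpha>) * p0) *\<^sub>R y0 \<in> (*\<^sub>R) (\<alpha> * p1 + (1 - \<alpha>) * p0) ` C"
    using assms convex_comb_pos[of p0 p1 \<alpha>] by (intro convex_nonneg_comb_in_scaled) auto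
  then show ?thesis
    by (auto simp: scaleR_matrix_vector_assoc[symmetric] matrix_vector_mult_add_rdistrib
        scaleR_add_left[symmetric])
qed

lemma diagonal_matrix_vector_mult:
  fixes P :: "'a::comm_semiring_1^'n^'n"
  assumes "\<And>i j. i \<noteq> j \<Longrightarrow> P $ i $ j = 0"
  shows "(P *v v) $ j = P $ j $ j * v $ j"
proof -
  have "(P *v v) $ j = (\<Sum>i\<in>UNIV. if i = j then P $ j $ j * v $ j else 0)"
    unfolding matrix_vector_mult_def vec_lambda_beta by (rule sum.cong) (auto simp: assms)
  then show ?thesis by simp
qed

lemma convex_box_mix_diagonal_matrices:
  fixes P0 P1 :: "real^'n^'n" and I :: "'n \<Rightarrow> real set"
  assumes convex: "\<And>j. convex (I j)"
    and y: "\<And>j. y0 $ j \<in> I j" "\<And>j. y1 $ j \<in> I j"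
    and \<alpha>: "0 \<le> \<alpha>" "\<alpha> \<le> 1"
    and diag: "\<And>i j. i \<noteq> j \<Longrightarrow> P0 $ i $ j = 0" "\<And>i j. i \<noteq> j \<Longrightarrow> P1 $ i $ j = 0"
    and pos: "\<And>j. 0 < P0 $ j $ j" "\<And>j. 0 < P1 $ j $ j"
  shows "\<alpha> *\<^sub>R (P1 *v y1) + (1 - \<alpha>) *\<^sub>R (P0 *v y0)
    \<in> (*v) (\<alpha> *\<^sub>R P1 + (1 - \<alpha>) *\<^sub>R P0) ` {y. \<forall>j. y $ j \<in> I j}"
proof -
  define P where "P = \<alpha> *\<^sub>R P1 + (1 - \<alpha>) *\<^sub>R P0"
  have "\<forall>j. \<exists>c \<in> I j. P $ j $ j * c = \<alpha> * P1 $ j $ j * y1 $ j + (1 - \<alpha>) * P0 $ j $ j * y0 $ j"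
  proof
    fix j
    have "(\<alpha> * P1 $ j $ j) *\<^sub>R y1 $ j + ((1 - \<alpha>) * P0 $ j $ j) *\<^sub>R y0 $ j
        \<in> (*\<^sub>R) (\<alpha> * P1 $ j $ j + (1 - \<alpha>) * P0 $ j $ j) ` I j"
      using convex y \<alpha> pos convex_comb_pos[of "P0 $ j $ j" "P1 $ j $ j" \<alpha>]
      by (intro convex_nonneg_comb_in_scaled) (auto intro!: mult_nonneg_nonneg simp: less_imp_le)
    then show "\<exists>c \<in> I j. P $ j $ j * c = \<alpha> * P1 $ j $ j * y1 $ j + (1 - \<alpha>) * P0 $ j $ j * y0 $ j"
      unfolding P_def by auto
  qed
  then obtain c where c: "\<And>j. c j \<in> I j"
    and Pc: "\<And>j. P $ j $ j * c j = \<alpha> * P1 $ j $ j * y1 $ j + (1 - \<alpha>) * P0 $ j $ j * y0 $ j"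
    by metis
  have "\<And>i j. i \<noteq> j \<Longrightarrow> P $ i $ j = 0"
    unfolding P_def using diag by simp
  then have "\<alpha> *\<^sub>R (P1 *v y1) + (1 - \<alpha>) *\<^sub>R (P0 *v y0) = P *v (\<chi> j. c j)"
    by (simp add: vec_eq_iff diagonal_matrix_vector_mult diag Pc mult.assoc)
  with c show ?thesis
    unfolding P_def by auto
qed

lemma convex_ereal_interval: "convex {t. a \<le> ereal t \<and> ereal t \<le> b}"
  unfolding is_interval_convex_1[symmetric] is_interval_1
  by (metis (mono_tags, lifting) ereal_less_eq(3) mem_Collect_eq order_trans)

theorem lemma3:
  fixes Q :: "real^'n \<Rightarrow> 'z::countable"
    and S :: "real^'m^'n"
    and z :: 'z
    and x0 x1 :: "real^'m"
    and P0 P1 :: "real^'n^'n"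
    and \<alpha> :: real
  assumes P0: "pos_def_mat P0" and P1: "pos_def_mat P1"
    and \<alpha>: "0 \<le> \<alpha>" "\<alpha> \<le> 1"
    and cases:
      "(convex (Q -` {z}) \<and> P1 = P0)
       \<or> (convex (Q -` {z}) \<and> (\<exists>\<psi>0 \<psi>1::real. \<psi>0 > 0 \<and> \<psi>1 > 0 \<and>
            P0 = \<psi>0 *\<^sub>R mat 1 \<and> P1 = \<psi>1 *\<^sub>R mat 1))
       \<or> ((\<forall>i j. i \<noteq> j \<longrightarrow> P0 $ i $ j = 0 \<and> P1 $ i $ j = 0)
          \<and> (\<forall>i. P0 $ i $ i > 0 \<and> P1 $ i $ i > 0)
          \<and> (\<exists>a b :: 'n \<Rightarrow> ereal. (\<forall>j. a j \<le> b j) \<and>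
               Q -` {z} = {y. \<forall>j. a j \<le> ereal (y $ j) \<and> ereal (y $ j) \<le> b j}))"
  shows "{\<alpha> *\<^sub>R w1 + (1 - \<alpha>) *\<^sub>R w0 | w1 w0.
            w1 \<in> Wset Q S z x1 P1 \<and> w0 \<in> Wset Q S z x0 P0}
         \<subseteq> Wset Q S z (\<alpha> *\<^sub>R x1 + (1 - \<alpha>) *\<^sub>R x0) (\<alpha> *\<^sub>R P1 + (1 - \<alpha>) *\<^sub>R P0)"
proof (rule Wset_convex_comb_subset)
  show "invertible P0" "invertible P1" "invertible (\<alpha> *\<^sub>R P1 + (1 - \<alpha>) *\<^sub>R P0)"
    using P0 P1 \<alpha> by (simp_all add: pos_def_mat_invertible pos_def_mat_convex_comb)
next
  fix y0 y1
  assume y: "y0 \<in> Q -` {z}" "y1 \<in> Q -` {z}"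
  from cases show "\<alpha> *\<^sub>R (P1 *v y1) + (1 - \<alpha>) *\<^sub>R (P0 *v y0)
    \<in> (*v) (\<alpha> *\<^sub>R P1 + (1 - \<alpha>) *\<^sub>R P0) ` (Q -` {z})"
  proof (elim disjE conjE exE)
    assume C: "convex (Q -` {z})" and "P1 = P0"
    then show ?thesis
      using convex_mix_same_matrix[OF C y \<alpha>] by simp
  next
    fix \<psi>0 \<psi>1 :: real
    assume C: "convex (Q -` {z})" and \<psi>: "0 < \<psi>0" "0 < \<psi>1"
      and "P0 = \<psi>0 *\<^sub>R mat 1" "P1 = \<psi>1 *\<^sub>R mat 1"
    then show ?thesis
      using convex_mix_scalar_matrices[OF C y \<alpha> \<psi>] by simp
  next
    fix a b :: "'n \<Rightarrow> ereal"
    assume "\<forall>i j. i \<noteq> j \<longrightarrow> P0 $ i $ j = 0 \<and> P1 $ i $ j = 0" "\<forall>i. 0 < P0 $ i $ i \<and> 0 < P1 $ i $ i"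
      and "Q -` {z} = {y. \<forall>j. a j \<le> ereal (y $ j) \<and> ereal (y $ j) \<le> b j}"
    then show ?thesis
      using convex_box_mix_diagonal_matrices[of "\<lambda>j. {t. a j \<le> ereal t \<and> ereal t \<le> b j}"]
        convex_ereal_interval y \<alpha> by simp
  qed
qed

end
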